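(* Let $I:=\{1,\ldots,m\}$ and $U:=U_mU_{m-1}\cdots U_1$ (composition), where $U_i\colon\mathcal H\to\mathcal H$ is $\rho_i$-strongly quasi-nonexpansive for $i\in I$. Assume that $\rho:=\min_{i\in I}\rho_i>0$ and $F_0:=\bigcap_{i\in I}\operatorname{Fix}U_i\ne\emptyset$. Let $S:=B(z,R)$ for some $z\in F_0$ and $R>0$. (i) Suppose that for every $i\in I$, $U_i$ is weakly regular over $S$. Then $U$ is weakly regular over $S$. (ii) Suppose that for every $i\in I$, $U_i$ is regular over $S$ and the family $\{\operatorname{Fix}U_i\mid i\in I\}$ is regular over $S$. Then $U$ is regular over $S$. (iii) Suppose that for every $i\in I$, $U_i$ is linearly regular over $S$ with modulus $\delta_i\ge 1$, let $\delta:=\min_{i\in I}\delta_i>0$, and suppose that the family $\{\operatorname{Fix}U_i\mid i\in I\}$ is linearly regular over $S$ with modulus $\kappa>0$. Then $U$ is linearly regular over $S$ with modulus $2m\kappa^2\delta^2/\rho$.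
   Context: $\mathcal H$ is a real Hilbert space, $\operatorname{Fix}U:=\{x\in\mathcal H\mid Ux=x\}$, $d(x,C):=\inf_{y\in C}\|x-y\|$, and $B(z,R):=\{x\in\mathcal H\mid\|x-z\|\le R\}$. For $\rho\ge 0$, an operator $T\colon\mathcal H\to\mathcal H$ is $\rho$-strongly quasi-nonexpansive if $\operatorname{Fix}T\ne\emptyset$ and $\|Tu-z\|^2\le\|u-z\|^2-\rho\|Tu-u\|^2$ for all $u\in\mathcal H$, $z\in\operatorname{Fix}T$; it is quasi-nonexpansive if this holds with $\rho=0$ (in that case $\operatorname{Fix}T$ is closed and convex). Regular operators. Let $S\subseteq\mathcal H$ be nonempty. A quasi-nonexpansive operator $V\colon\mathcal H\to\mathcal H$ is: (a) weakly regular over $S$ if for every sequence $\{x^k\}_{k=0}^\infty\subseteq S$ and every strictly increasing sequence $\{n_k\}$ of nonnegative integers, $x^{n_k}\rightharpoonup y$ (weakly) and $\|Vx^k-x^k\|\to 0$ imply $y\in\operatorname{Fix}V$; (b) regular over $S$ if for every sequence $\{x^k\}_{k=0}^\infty\subseteq S$, $\|Vx^k-x^k\|\to 0$ implies $d(x^k,\operatorname{Fix}V)\to 0$; (c) linearly regular over $S$ with modulus $\delta>0$ if $d(x,\operatorname{Fix}V)\le\delta\|Vx-x\|$ for all $x\in S$. Regular families of sets. A family of closed convex sets $C_i$, $i\in I=\{1,\ldots,m\}$, with $C=\bigcap_{i\in I}C_i\neq\emptyset$ is regular over $S$ if for every sequence $\{x^k\}_{k=0}^\infty\subseteq S$, $\max_{i\in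 I}d(x^k,C_i)\to 0$ implies $d(x^k,C)\to 0$; it is linearly regular over $S$ with modulus $\kappa>0$ if $d(x,C)\le\kappa\max_{i\in I}d(x,C_i)$ for all $x\in S$.
   Formalization: In (iii), δ is taken as the maximum of the δ_i instead of the minimum; with the minimum the claim fails, e.g. on the real line for U_1 x = x/2, U_2 x = x, ρ_1 = ρ_2 = 3, δ_1 = 2, δ_2 = 1, κ = 1, z = 0, R = 1. *)

theory Defs
  imports "HOL-Analysis.Analysis"
begin

text \<open>A real Hilbert space is a type of sort \<open>{real_inner, complete_space}\<close>. The closed
  ball \<open>B(z,R)\<close> is \<^term>\<open>cball z R\<close> and the distance \<open>d(x,C)\<close> is \<^term>\<open>infdist x C\<close>; the
  library's convention \<^prop>\<open>infdist x {} = 0\<close> is immaterial, since every set of which a distance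
  is taken below is required to be nonempty.\<close>

definition Fix :: "('a \<Rightarrow> 'a) \<Rightarrow> 'a set" where
  "Fix T = {x. T x = x}"

definition strongly_quasi_nonexpansive ::
  "real \<Rightarrow> ('a::{real_inner,complete_space} \<Rightarrow> 'a) \<Rightarrow> bool" where
  "strongly_quasi_nonexpansive \<rho> T \<longleftrightarrow> \<rho> \<ge> 0 \<and> Fix T \<noteq> {} \<and>
     (\<forall>u. \<forall>z\<in>Fix T. (norm (T u - z))\<^sup>2 \<le> (norm (u - z))\<^sup>2 - \<rho> * (norm (T u - u))\<^sup>2)"

definition quasi_nonexpansive :: "('a::{real_inner,complete_space} \<Rightarrow> 'a) \<Rightarrow> bool" where
  "quasi_nonexpansive T \<longleftrightarrow> strongly_quasi_nonexpansive 0 T"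

definition weakly_converges ::
  "(nat \<Rightarrow> 'a::{real_inner,complete_space}) \<Rightarrow> 'a \<Rightarrow> bool" where
  "weakly_converges x y \<longleftrightarrow>
     (\<forall>f :: 'a \<Rightarrow> real. bounded_linear f \<longrightarrow> (\<lambda>k. f (x k)) \<longlonglongrightarrow> f y)"

text \<open>In \<open>weakly_regular_over\<close> only the subsequence converges weakly, whereas
  \<open>\<parallel>V x\<^sup>k - x\<^sup>k\<parallel> \<rightarrow> 0\<close> is required along the whole sequence.\<close>

definition weakly_regular_over ::
  "('a::{real_inner,complete_space} \<Rightarrow> 'a) \<Rightarrow> 'a set \<Rightarrow> bool" where
  "weakly_regular_over V S \<longleftrightarrow> quasi_nonexpansive V \<and>
     (\<forall>(x :: nat \<Rightarrow> 'a) (n :: nat \<Rightarrow> nat) y.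
        (\<forall>k. x k \<in> S) \<longrightarrow> strict_mono n \<longrightarrow> weakly_converges (\<lambda>k. x (n k)) y \<longrightarrow>
        (\<lambda>k. norm (V (x k) - x k)) \<longlonglongrightarrow> 0 \<longrightarrow> y \<in> Fix V)"

definition regular_over ::
  "('a::{real_inner,complete_space} \<Rightarrow> 'a) \<Rightarrow> 'a set \<Rightarrow> bool" where
  "regular_over V S \<longleftrightarrow> quasi_nonexpansive V \<and>
     (\<forall>x :: nat \<Rightarrow> 'a. (\<forall>k. x k \<in> S) \<longrightarrow> (\<lambda>k. norm (V (x k) - x k)) \<longlonglongrightarrow> 0 \<longrightarrow>
        (\<lambda>k. infdist (x k) (Fix V)) \<longlonglongrightarrow> 0)"

definition linearly_regular_over ::
  "('a::{real_inner,complete_space} \<Rightarrow> 'a) \<Rightarrow> 'a set \<Rightarrow> real \<Rightarrow> bool" where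
  "linearly_regular_over V S \<delta> \<longleftrightarrow> quasi_nonexpansive V \<and> \<delta> > 0 \<and>
     (\<forall>x\<in>S. infdist x (Fix V) \<le> \<delta> * norm (V x - x))"

text \<open>A family of sets is indexed by \<open>{1..m}\<close>. The values of \<open>C\<close> outside this range are
  irrelevant.\<close>

definition closed_convex_family :: "nat \<Rightarrow> (nat \<Rightarrow> 'a::{real_inner,complete_space} set) \<Rightarrow> bool" where
  "closed_convex_family m C \<longleftrightarrow>
     (\<forall>i\<in>{1..m}. closed (C i) \<and> convex (C i)) \<and> (\<Inter>i\<in>{1..m}. C i) \<noteq> {}"

definition regular_family_over ::
  "nat \<Rightarrow> (nat \<Rightarrow> 'a::{real_inner,complete_space} set) \<Rightarrow> 'a set \<Rightarrow> bool" where
  "regular_family_over m C S \<longleftrightarrow> closed_convex_family m C \<and>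
     (\<forall>x :: nat \<Rightarrow> 'a. (\<forall>k. x k \<in> S) \<longrightarrow>
        (\<lambda>k. Max ((\<lambda>i. infdist (x k) (C i)) ` {1..m})) \<longlonglongrightarrow> 0 \<longrightarrow>
        (\<lambda>k. infdist (x k) (\<Inter>i\<in>{1..m}. C i)) \<longlonglongrightarrow> 0)"

definition linearly_regular_family_over ::
  "nat \<Rightarrow> (nat \<Rightarrow> 'a::{real_inner,complete_space} set) \<Rightarrow> 'a set \<Rightarrow> real \<Rightarrow> bool" where
  "linearly_regular_family_over m C S \<kappa> \<longleftrightarrow> closed_convex_family m C \<and> \<kappa> > 0 \<and>
     (\<forall>x\<in>S. infdist x (\<Inter>i\<in>{1..m}. C i) \<le> \<kappa> * Max ((\<lambda>i. infdist x (C i)) ` {1..m}))"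

text \<open>\<open>U\<^sub>m \<circ> \<dots> \<circ> U\<^sub>1\<close>: \<^term>\<open>fold\<close> applies the operator at the head of the list, \<open>U\<^sub>1\<close>, first.\<close>

definition composition :: "nat \<Rightarrow> (nat \<Rightarrow> 'a \<Rightarrow> 'a) \<Rightarrow> 'a \<Rightarrow> 'a" where
  "composition m U = fold U [1..<Suc m]"

text \<open>For linear regularity the modulus of the composition is stated with the largest
  of the moduli \<open>\<delta>\<^sub>i\<close>, not the smallest as in the source, for which the claim fails: on the real line take \<open>m = 2\<close>,
  \<open>U\<^sub>1 x = x / 2\<close>, \<open>U\<^sub>2 x = x\<close>, \<open>\<rho>\<^sub>1 = \<rho>\<^sub>2 = 3\<close>, \<open>\<delta>\<^sub>1 = 2\<close>, \<open>\<delta>\<^sub>2 = 1\<close>, \<open>\<kappa> = 1\<close>. The smallest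
  modulus would give \<open>4 / 3\<close>, but \<open>d(x, Fix U) = 2 \<bar>U x - x\<bar>\<close>.\<close>

text \<open>The fixed point set of a quasi-nonexpansive operator is closed and convex, so for families
  of such sets \<open>closed_convex_family\<close> only asks for a common fixed point.\<close>

lemma closed_convex_Fix:
  fixes T :: "'a::{real_inner,complete_space} \<Rightarrow> 'a"
  assumes "quasi_nonexpansive T"
  shows "closed (Fix T)" "convex (Fix T)"
proof -
  let ?H = "\<lambda>u. {z. (2 *\<^sub>R (u - T u)) \<bullet> z \<le> u \<bullet> u - T u \<bullet> T u}"
  have H: "(norm (T u - z))\<^sup>2 \<le> (norm (u - z))\<^sup>2 \<longleftrightarrow> z \<in> ?H u" for u z
    by (simp add: power2_norm_eq_inner inner_diff_left inner_diff_right inner_commute)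
       (auto simp: algebra_simps)
  have "Fix T = (\<Inter>u. ?H u)"
  proof (intro equalityI subsetI)
    fix z assume "z \<in> Fix T"
    then show "z \<in> (\<Inter>u. ?H u)"
      using assms H by (auto simp: quasi_nonexpansive_def strongly_quasi_nonexpansive_def)
  next
    fix z assume "z \<in> (\<Inter>u. ?H u)"
    then have "z \<in> ?H z" by blast
    then have "(norm (T z - z))\<^sup>2 \<le> (norm (z - z))\<^sup>2" using H[of z z] by blast
    then show "z \<in> Fix T" by (simp add: Fix_def)
  qed
  moreover have "closed (\<Inter>u. ?H u)"
    by (intro closed_INT ballI closed_halfspace_le)
  moreover have "convex (\<Inter>u. ?H u)"
    by (intro convex_INT convex_halfspace_le)
  ultimately show "closed (Fix T)" "convex (Fix T)" by simp_all
qed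

end

theory Submission
  imports Defs
begin

text \<open>The three claims share one estimate. Follow a point \<open>x\<close> through the partial products
  \<open>x\<^sub>j = U\<^sub>j \<dots> U\<^sub>1 x\<close>. At a common fixed point \<open>p\<close> the defining inequalities of the factors telescope to
  \<open>\<rho> \<Sum>\<^sub>j \<parallel>x\<^sub>j\<^sub>+\<^sub>1 - x\<^sub>j\<parallel>\<^sup>2 \<le> \<parallel>x - p\<parallel>\<^sup>2 - \<parallel>U x - p\<parallel>\<^sup>2 \<le> 2 \<parallel>x - p\<parallel> \<parallel>U x - x\<parallel>\<close>,
  where the second step factors the difference of squares and uses the triangle inequality
  (\<open>sum_steps_squared_le\<close>). So a point which \<open>U\<close> hardly moves takes only short steps
  through the partial products.
  In particular \<open>Fix U\<close> is the intersection of the sets \<open>Fix U\<^sub>i\<close> (\<open>Fix_composition\<close>), and if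
  \<open>\<parallel>U x\<^sup>k - x\<^sup>k\<parallel> \<rightarrow> 0\<close> along a bounded sequence, then all the steps vanish in the limit
  (\<open>step_tendsto_0\<close>) and every intermediate sequence is asymptotic to \<open>x\<^sup>k\<close>.

  Balls around a common fixed point are invariant under every \<open>U\<^sub>i\<close>, so the regularity of \<open>U\<^sub>i\<close> may be
  applied to the intermediate sequence that enters \<open>U\<^sub>i\<close>. Its conclusion carries over to \<open>x\<^sup>k\<close>
  itself: the two sequences have the same weak limits, and their distances to \<open>Fix U\<^sub>i\<close> differ by at
  most the sum of the steps taken (\<open>infdist_Fix_factor_le\<close>).

  For linear regularity, let \<open>D = d(x, Fix U)\<close>. Linear regularity of the factors and of the family
  bounds \<open>D\<close> by \<open>\<kappa> \<delta>\<close> times the sum of the steps, \<open>\<delta>\<close> being the largest modulus. Squaring, Cauchy--Schwarz and the estimate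
  above give \<open>D\<^sup>2 \<le> c \<parallel>U x - x\<parallel> \<parallel>x - p\<parallel>\<close> for every \<open>p \<in> Fix U\<close>, with \<open>c = 2 m \<kappa>\<^sup>2 \<delta>\<^sup>2 / \<rho>\<close>.
  Taking the infimum over \<open>p\<close> turns the right-hand side into \<open>c \<parallel>U x - x\<parallel> D\<close>, and a factor
  \<open>D\<close> cancels.\<close>

section \<open>Preliminaries\<close>

lemma strongly_quasi_nonexpansiveD:
  assumes "strongly_quasi_nonexpansive \<rho> T" "p \<in> Fix T"
  shows "(norm (T u - p))\<^sup>2 \<le> (norm (u - p))\<^sup>2 - \<rho> * (norm (T u - u))\<^sup>2"
  using assms by (auto simp: strongly_quasi_nonexpansive_def)

lemma strongly_quasi_nonexpansive_antimono:
  assumes "strongly_quasi_nonexpansive \<rho> T" "0 \<le> \<sigma>" "\<sigma> \<le> \<rho>"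
  shows "strongly_quasi_nonexpansive \<sigma> T"
  unfolding strongly_quasi_nonexpansive_def
proof (intro conjI allI ballI)
  fix u p assume p: "p \<in> Fix T"
  have "\<sigma> * (norm (T u - u))\<^sup>2 \<le> \<rho> * (norm (T u - u))\<^sup>2"
    using assms(3) by (simp add: mult_right_mono)
  with strongly_quasi_nonexpansiveD[OF assms(1) p, of u]
  show "(norm (T u - p))\<^sup>2 \<le> (norm (u - p))\<^sup>2 - \<sigma> * (norm (T u - u))\<^sup>2" by linarith
qed (use assms in \<open>auto simp: strongly_quasi_nonexpansive_def\<close>)

lemma composition_0 [simp]: "composition 0 U x = x"
  by (simp add: composition_def)

lemma composition_Suc [simp]: "composition (Suc n) U x = U (Suc n) (composition n U x)"
  by (simp add: composition_def)

lemma weakly_converges_asymptotic: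
  assumes "weakly_converges x y" "(\<lambda>k. x' k - x k) \<longlonglongrightarrow> 0"
  shows "weakly_converges x' y"
  unfolding weakly_converges_def
proof (intro allI impI)
  fix f :: "'a \<Rightarrow> real" assume f: "bounded_linear f"
  then have "(\<lambda>k. f (x k)) \<longlonglongrightarrow> f y"
    using assms(1) by (simp add: weakly_converges_def)
  moreover have "(\<lambda>k. f (x' k - x k)) \<longlonglongrightarrow> 0"
    by (rule bounded_linear.tendsto_zero[OF f assms(2)])
  ultimately have "(\<lambda>k. f (x k) + f (x' k - x k)) \<longlonglongrightarrow> f y + 0"
    by (rule tendsto_add)
  then show "(\<lambda>k. f (x' k)) \<longlonglongrightarrow> f y"
    by (simp add: linear_diff[OF bounded_linear.linear[OF f]])
qed

lemma le_mult_infdist: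
  assumes "A \<noteq> {}" "0 \<le> c" "\<And>p. p \<in> A \<Longrightarrow> b \<le> c * dist x p"
  shows "b \<le> c * infdist x A"
proof (cases "c = 0")
  case True
  then show ?thesis using assms by auto
next
  case False
  with assms(2) have c: "c > 0" by simp
  have "b / c \<le> infdist x A"
    unfolding infdist_notempty[OF assms(1)]
    by (rule cINF_greatest[OF assms(1)]) (use assms(3) c in \<open>simp add: field_simps\<close>)
  then show ?thesis using c by (simp add: field_simps)
qed

section \<open>The steps of a product of strongly quasi-nonexpansive operators\<close>

text \<open>The constants \<open>\<rho>\<^sub>i\<close> of the factors enter only through their minimum, hence the common \<open>\<rho>\<close>.\<close>

locale strongly_quasi_nonexpansive_product =
  fixes U :: "nat \<Rightarrow> 'a::{real_inner,complete_space} \<Rightarrow> 'a" and m :: nat and \<rho> :: real and z :: 'a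
  assumes sqne: "i \<in> {1..m} \<Longrightarrow> strongly_quasi_nonexpansive \<rho> (U i)"
    and rho_pos: "\<rho> > 0"
    and z_common: "z \<in> (\<Inter>i\<in>{1..m}. Fix (U i))"
begin

definition step :: "'a \<Rightarrow> nat \<Rightarrow> real" where
  "step x j = norm (composition (Suc j) U x - composition j U x)"

lemma step_nonneg: "0 \<le> step x j"
  by (simp add: step_def)

lemma norm_composition_squared_le:
  assumes p: "p \<in> (\<Inter>i\<in>{1..m}. Fix (U i))" and "n \<le> m"
  shows "(norm (composition n U x - p))\<^sup>2 \<le> (norm (x - p))\<^sup>2 - \<rho> * (\<Sum>j<n. (step x j)\<^sup>2)"
  using \<open>n \<le> m\<close>
proof (induction n)
  case (Suc n)
  then have "Suc n \<in> {1..m}" by simp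
  then have "(norm (composition (Suc n) U x - p))\<^sup>2
      \<le> (norm (composition n U x - p))\<^sup>2 - \<rho> * (step x n)\<^sup>2"
    using strongly_quasi_nonexpansiveD[OF sqne, of "Suc n" p "composition n U x"] p
    by (auto simp: step_def)
  with Suc show ?case by (simp add: algebra_simps)
qed simp

lemma norm_composition_le:
  assumes "p \<in> (\<Inter>i\<in>{1..m}. Fix (U i))" "n \<le> m"
  shows "norm (composition n U x - p) \<le> norm (x - p)"
proof -
  have "0 \<le> \<rho> * (\<Sum>j<n. (step x j)\<^sup>2)"
    using rho_pos by (simp add: sum_nonneg)
  then have "(norm (composition n U x - p))\<^sup>2 \<le> (norm (x - p))\<^sup>2"
    using norm_composition_squared_le[OF assms, of x] by linarith
  then show ?thesis by (rule power2_le_imp_le) simp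
qed

lemma composition_in_cball:
  assumes "x \<in> cball z R" "n \<le> m"
  shows "composition n U x \<in> cball z R"
  using norm_composition_le[OF z_common assms(2), of x] assms(1)
  by (simp add: dist_norm norm_minus_commute)

text \<open>The right-hand side has only the first power of the displacement \<open>\<parallel>U x - x\<parallel>\<close>, but also
  a factor \<open>\<parallel>x - p\<parallel>\<close>. On a ball around \<open>p\<close> this factor is bounded, which suffices for the
  qualitative results; for a rate it is essential that \<open>p\<close> may be chosen close to \<open>x\<close>.\<close>

lemma sum_steps_squared_le:
  assumes "p \<in> (\<Inter>i\<in>{1..m}. Fix (U i))"
  shows "\<rho> * (\<Sum>j<m. (step x j)\<^sup>2) \<le> 2 * norm (x - p) * norm (composition m U x - x)"
proof -
  let ?a = "norm (x - p)" and ?b = "norm (composition m U x - p)"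
    and ?d = "norm (composition m U x - x)"
  have ba: "?b \<le> ?a" using norm_composition_le[OF assms] by simp
  have "?a \<le> ?d + ?b"
    using norm_triangle_ineq4[of "composition m U x - p" "composition m U x - x"] by simp
  have "\<rho> * (\<Sum>j<m. (step x j)\<^sup>2) \<le> ?a\<^sup>2 - ?b\<^sup>2"
    using norm_composition_squared_le[OF assms, of m x] by simp
  also have "\<dots> = (?a + ?b) * (?a - ?b)"
    by (simp add: power2_eq_square algebra_simps)
  also have "\<dots> \<le> (2 * ?a) * ?d"
    using ba \<open>?a \<le> ?d + ?b\<close> by (intro mult_mono) auto
  finally show ?thesis by simp
qed

lemma dist_composition_le_sum_steps: "dist (composition n U x) x \<le> (\<Sum>j<n. step x j)"
proof (induction n)
  case (Suc n)
  have "dist (composition (Suc n) U x) x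
      \<le> dist (composition (Suc n) U x) (composition n U x) + dist (composition n U x) x"
    by (rule dist_triangle)
  with Suc show ?case by (simp add: step_def dist_norm)
qed simp

text \<open>Regularity of \<open>U\<^sub>n\<^sub>+\<^sub>1\<close> controls the distance of its input to \<open>Fix U\<^sub>n\<^sub>+\<^sub>1\<close>, whereas
  regularity of the family asks for the distance of the starting point. The two differ by at most the
  length of the path between them.\<close>

lemma infdist_Fix_factor_le:
  assumes "n < m"
  shows "infdist x (Fix (U (Suc n)))
    \<le> infdist (composition n U x) (Fix (U (Suc n))) + (\<Sum>j<n. step x j)"
  using infdist_triangle[of x "Fix (U (Suc n))" "composition n U x"]
    dist_composition_le_sum_steps[of n x] by (simp add: dist_commute)

text \<open>If the whole product fixes \<open>x\<close>, then the estimate at \<open>z\<close> leaves no room for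
  a single nonzero step, so \<open>x\<close> passes unchanged through every factor.\<close>

lemma Fix_composition: "Fix (composition m U) = (\<Inter>i\<in>{1..m}. Fix (U i))"
proof (intro equalityI subsetI)
  fix x assume "x \<in> Fix (composition m U)"
  then have "\<rho> * (\<Sum>j<m. (step x j)\<^sup>2) \<le> 0"
    using sum_steps_squared_le[OF z_common, of x] by (simp add: Fix_def)
  then have "(\<Sum>j<m. (step x j)\<^sup>2) \<le> 0"
    using rho_pos by (simp add: mult_le_0_iff)
  then have "(\<Sum>j<m. (step x j)\<^sup>2) = 0"
    by (intro antisym sum_nonneg) auto
  then have step0: "step x j = 0" if "j < m" for j
    using that by (simp add: sum_nonneg_eq_0_iff)
  have "x \<in> Fix (U i)" if i: "i \<in> {1..m}" for i
  proof -
    obtain n where n: "i = Suc n" "n < m" using i by (cases i) auto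
    have "dist (composition n U x) x \<le> 0"
      using dist_composition_le_sum_steps[of n x] step0 n(2) by simp
    then have "composition n U x = x" by simp
    then show ?thesis using step0[OF n(2)] n by (simp add: step_def Fix_def)
  qed
  then show "x \<in> (\<Inter>i\<in>{1..m}. Fix (U i))" by blast
next
  fix x assume x: "x \<in> (\<Inter>i\<in>{1..m}. Fix (U i))"
  then show "x \<in> Fix (composition m U)"
    using norm_composition_le[OF x, of m x] by (simp add: Fix_def)
qed

lemma quasi_nonexpansive_composition: "quasi_nonexpansive (composition m U)"
  unfolding quasi_nonexpansive_def strongly_quasi_nonexpansive_def Fix_composition
proof (intro conjI allI ballI)
  show "(\<Inter>i\<in>{1..m}. Fix (U i)) \<noteq> {}" using z_common by blast
next
  fix u p assume "p \<in> (\<Inter>i\<in>{1..m}. Fix (U i))"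
  from norm_composition_le[OF this, of m u]
  show "(norm (composition m U u - p))\<^sup>2
      \<le> (norm (u - p))\<^sup>2 - 0 * (norm (composition m U u - u))\<^sup>2"
    by (simp add: power_mono)
qed simp

section \<open>Asymptotically fixed sequences\<close>

lemma step_tendsto_0:
  assumes x: "\<And>k. x k \<in> cball z R"
    and lim: "(\<lambda>k. norm (composition m U (x k) - x k)) \<longlonglongrightarrow> 0"
    and "j < m"
  shows "(\<lambda>k. step (x k) j) \<longlonglongrightarrow> 0"
proof -
  let ?d = "\<lambda>k. norm (composition m U (x k) - x k)"
  have bound: "(step (x k) j)\<^sup>2 \<le> 2 * R / \<rho> * ?d k" for k
  proof -
    have "\<rho> * (step (x k) j)\<^sup>2 \<le> \<rho> * (\<Sum>j<m. (step (x k) j)\<^sup>2)"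
      using \<open>j < m\<close> rho_pos by (intro mult_left_mono member_le_sum) auto
    also have "\<dots> \<le> 2 * norm (x k - z) * ?d k"
      by (rule sum_steps_squared_le[OF z_common])
    also have "\<dots> \<le> 2 * R * ?d k"
      using x[of k] by (intro mult_right_mono) (auto simp: dist_norm norm_minus_commute)
    finally show ?thesis using rho_pos by (simp add: field_simps)
  qed
  have "(\<lambda>k. 2 * R / \<rho> * ?d k) \<longlonglongrightarrow> 0"
    by (rule tendsto_mult_right_zero[OF lim])
  then have "(\<lambda>k. (step (x k) j)\<^sup>2) \<longlonglongrightarrow> 0"
    by (rule tendsto_sandwich[OF _ _ tendsto_const, rotated -1])
       (use bound in \<open>auto intro!: always_eventually\<close>)
  then have "(\<lambda>k. sqrt ((step (x k) j)\<^sup>2)) \<longlonglongrightarrow> sqrt 0"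
    by (rule tendsto_real_sqrt)
  then show ?thesis by (simp add: step_nonneg)
qed

lemma sum_steps_tendsto_0:
  assumes "\<And>k. x k \<in> cball z R"
    and "(\<lambda>k. norm (composition m U (x k) - x k)) \<longlonglongrightarrow> 0" and "n \<le> m"
  shows "(\<lambda>k. \<Sum>j<n. step (x k) j) \<longlonglongrightarrow> 0"
  by (rule tendsto_null_sum, rule step_tendsto_0[OF assms(1,2)]) (use assms(3) in auto)

section \<open>Regularity of the product\<close>

lemma weakly_regular_composition:
  assumes reg: "\<And>i. i \<in> {1..m} \<Longrightarrow> weakly_regular_over (U i) (cball z R)"
  shows "weakly_regular_over (composition m U) (cball z R)"
  unfolding weakly_regular_over_def
proof (intro conjI allI impI quasi_nonexpansive_composition)
  fix x :: "nat \<Rightarrow> 'a" and n :: "nat \<Rightarrow> nat" and y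
  assume x: "\<forall>k. x k \<in> cball z R" and n: "strict_mono n"
    and weak: "weakly_converges (\<lambda>k. x (n k)) y"
    and lim: "(\<lambda>k. norm (composition m U (x k) - x k)) \<longlonglongrightarrow> 0"
  have "y \<in> Fix (U i)" if i: "i \<in> {1..m}" for i
  proof -
    obtain l where l: "i = Suc l" "l < m" using i by (cases i) auto
    have "(\<lambda>k. norm (composition l U (x k) - x k)) \<longlonglongrightarrow> 0"
      by (rule tendsto_sandwich[OF _ _ tendsto_const sum_steps_tendsto_0[OF _ lim, of R l]])
         (use x l dist_composition_le_sum_steps in
           \<open>auto intro!: always_eventually simp: dist_norm\<close>)
    then have "(\<lambda>k. composition l U (x k) - x k) \<longlonglongrightarrow> 0"
      by (rule tendsto_norm_zero_cancel)
    from weakly_converges_asymptotic[OF weak LIMSEQ_subseq_LIMSEQ[OF this n, unfolded o_def]]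
    have "weakly_converges (\<lambda>k. composition l U (x (n k))) y" .
    moreover have "(\<lambda>k. norm (U i (composition l U (x k)) - composition l U (x k))) \<longlonglongrightarrow> 0"
      using step_tendsto_0[OF _ lim l(2), of R] x by (simp add: step_def l(1))
    moreover have "\<forall>k. composition l U (x k) \<in> cball z R"
      using composition_in_cball x l(2) by (meson less_imp_le)
    ultimately show ?thesis
      using reg[OF i] n unfolding weakly_regular_over_def
      by (elim conjE allE[of _ "\<lambda>k. composition l U (x k)"]) blast
  qed
  then show "y \<in> Fix (composition m U)" by (auto simp: Fix_composition)
qed

lemma regular_composition:
  assumes m: "m \<ge> 1"
    and reg: "\<And>i. i \<in> {1..m} \<Longrightarrow> regular_over (U i) (cball z R)"
    and fam: "regular_family_over m (\<lambda>i. Fix (U i)) (cball z R)"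
  shows "regular_over (composition m U) (cball z R)"
  unfolding regular_over_def
proof (intro conjI allI impI quasi_nonexpansive_composition)
  fix x :: "nat \<Rightarrow> 'a"
  assume x: "\<forall>k. x k \<in> cball z R"
    and lim: "(\<lambda>k. norm (composition m U (x k) - x k)) \<longlonglongrightarrow> 0"
  have tendsto: "(\<lambda>k. infdist (x k) (Fix (U i))) \<longlonglongrightarrow> 0" if i: "i \<in> {1..m}" for i
  proof -
    obtain l where l: "i = Suc l" "l < m" using i by (cases i) auto
    have "(\<lambda>k. norm (U i (composition l U (x k)) - composition l U (x k))) \<longlonglongrightarrow> 0"
      using step_tendsto_0[OF _ lim l(2), of R] x by (simp add: step_def l(1))
    moreover have "\<forall>k. composition l U (x k) \<in> cball z R"
      using composition_in_cball x l(2) by (meson less_imp_le)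
    ultimately have "(\<lambda>k. infdist (composition l U (x k)) (Fix (U i))) \<longlonglongrightarrow> 0"
      using reg[OF i] unfolding regular_over_def
      by (elim conjE allE[of _ "\<lambda>k. composition l U (x k)"]) blast
    moreover have "(\<lambda>k. \<Sum>j<l. step (x k) j) \<longlonglongrightarrow> 0"
      using sum_steps_tendsto_0[OF _ lim, of R l] x l(2) by simp
    ultimately have "(\<lambda>k. infdist (composition l U (x k)) (Fix (U i)) + (\<Sum>j<l. step (x k) j))
        \<longlonglongrightarrow> 0"
      by (rule tendsto_add_zero)
    then show ?thesis
      by (rule tendsto_sandwich[OF _ _ tendsto_const, rotated -1])
         (use infdist_Fix_factor_le[OF l(2)] l(1) in
           \<open>auto intro!: always_eventually simp: infdist_nonneg\<close>)
  qed
  \<comment> \<open>A maximum of finitely many nonnegative null sequences is dominated by their sum.\<close>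
  have "(\<lambda>k. Max ((\<lambda>i. infdist (x k) (Fix (U i))) ` {1..m})) \<longlonglongrightarrow> 0"
  proof (rule tendsto_sandwich[OF _ _ tendsto_const])
    show "(\<lambda>k. \<Sum>i\<in>{1..m}. infdist (x k) (Fix (U i))) \<longlonglongrightarrow> 0"
      by (rule tendsto_null_sum) (rule tendsto)
    show "\<forall>\<^sub>F k in sequentially. Max ((\<lambda>i. infdist (x k) (Fix (U i))) ` {1..m})
        \<le> (\<Sum>i\<in>{1..m}. infdist (x k) (Fix (U i)))"
      using m by (intro always_eventually allI Max.boundedI)
        (auto intro!: member_le_sum simp: infdist_nonneg)
    show "\<forall>\<^sub>F k in sequentially. 0 \<le> Max ((\<lambda>i. infdist (x k) (Fix (U i))) ` {1..m})"
      using m by (intro always_eventually allI) (auto simp: Max_ge_iff infdist_nonneg)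
  qed
  then show "(\<lambda>k. infdist (x k) (Fix (composition m U))) \<longlonglongrightarrow> 0"
    using fam x unfolding regular_family_over_def Fix_composition by blast
qed

text \<open>The hypothesis \<open>\<delta> \<ge> 1\<close> lets one constant serve for both parts of the bound on
  \<open>d(x, Fix U\<^sub>i)\<close>: the last step enters with the factor \<open>\<delta>\<close> from linear regularity, the earlier
  ones with the factor 1 from the triangle inequality.\<close>

lemma linearly_regular_composition:
  assumes m: "m \<ge> 1" and \<delta>: "\<delta> \<ge> 1"
    and reg: "\<And>i x. i \<in> {1..m} \<Longrightarrow> x \<in> cball z R \<Longrightarrow> infdist x (Fix (U i)) \<le> \<delta> * norm (U i x - x)"
    and fam: "linearly_regular_family_over m (\<lambda>i. Fix (U i)) (cball z R) \<kappa>"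
  shows "linearly_regular_over (composition m U) (cball z R) (2 * real m * \<kappa>\<^sup>2 * \<delta>\<^sup>2 / \<rho>)"
  unfolding linearly_regular_over_def
proof (intro conjI ballI quasi_nonexpansive_composition)
  have \<kappa>: "\<kappa> > 0" using fam by (simp add: linearly_regular_family_over_def)
  show "2 * real m * \<kappa>\<^sup>2 * \<delta>\<^sup>2 / \<rho> > 0" using m \<delta> \<kappa> rho_pos by simp
  fix x assume x: "x \<in> cball z R"
  define F where "F = (\<Inter>i\<in>{1..m}. Fix (U i))"
  define D where "D = infdist x F"
  let ?d = "norm (composition m U x - x)" and ?c = "2 * real m * \<kappa>\<^sup>2 * \<delta>\<^sup>2 / \<rho>"
  have D0: "0 \<le> D" by (simp add: D_def infdist_nonneg)
  have factor: "infdist x (Fix (U i)) \<le> \<delta> * (\<Sum>j<m. step x j)" if i: "i \<in> {1..m}" for i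
  proof -
    obtain l where l: "i = Suc l" "l < m" using i by (cases i) auto
    have "infdist (composition l U x) (Fix (U (Suc l))) \<le> \<delta> * step x l"
      using reg[OF i composition_in_cball[OF x, of l]] l by (simp add: step_def)
    moreover have "(\<Sum>j<l. step x j) \<le> \<delta> * (\<Sum>j<l. step x j)"
      using mult_right_mono[OF \<delta>, of "\<Sum>j<l. step x j"] by (simp add: sum_nonneg step_nonneg)
    ultimately have "infdist x (Fix (U i)) \<le> \<delta> * (\<Sum>j<Suc l. step x j)"
      using infdist_Fix_factor_le[OF l(2), of x] l(1) by (simp add: algebra_simps)
    also have "\<dots> \<le> \<delta> * (\<Sum>j<m. step x j)"
      using \<delta> l(2) by (intro mult_left_mono sum_mono2) (auto simp: step_nonneg)
    finally show ?thesis .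
  qed
  have "D \<le> \<kappa> * Max ((\<lambda>i. infdist x (Fix (U i))) ` {1..m})"
    using fam x by (simp add: linearly_regular_family_over_def D_def F_def)
  also have "\<dots> \<le> \<kappa> * (\<delta> * (\<Sum>j<m. step x j))"
    using m \<kappa> factor by (intro mult_left_mono Max.boundedI) auto
  finally have "D\<^sup>2 \<le> (\<kappa> * (\<delta> * (\<Sum>j<m. step x j)))\<^sup>2"
    using D0 by (simp add: power_mono)
  also have "\<dots> = \<kappa>\<^sup>2 * \<delta>\<^sup>2 * (\<Sum>j<m. step x j)\<^sup>2"
    by (simp add: power_mult_distrib)
  also have "\<dots> \<le> \<kappa>\<^sup>2 * \<delta>\<^sup>2 * (real m * (\<Sum>j<m. (step x j)\<^sup>2))"
    using Cauchy_Schwarz_ineq_sum[of "\<lambda>_. 1" "step x" "{..<m}"]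
    by (intro mult_left_mono) auto
  finally have D2: "D\<^sup>2 \<le> \<kappa>\<^sup>2 * \<delta>\<^sup>2 * real m / \<rho> * (\<rho> * (\<Sum>j<m. (step x j)\<^sup>2))"
    using rho_pos by (simp add: mult.assoc)
  \<comment> \<open>The left-hand side does not depend on \<open>p\<close>, so \<open>dist x p\<close> may be replaced by its infimum \<open>D\<close>.\<close>
  have "D\<^sup>2 \<le> (?c * ?d) * dist x p" if p: "p \<in> F" for p
  proof -
    have "\<kappa>\<^sup>2 * \<delta>\<^sup>2 * real m / \<rho> * (\<rho> * (\<Sum>j<m. (step x j)\<^sup>2))
        \<le> \<kappa>\<^sup>2 * \<delta>\<^sup>2 * real m / \<rho> * (2 * norm (x - p) * ?d)"
      using sum_steps_squared_le[of p x] p rho_pos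
      by (intro mult_left_mono) (auto simp: F_def)
    with D2 show ?thesis by (simp add: dist_norm mult_ac)
  qed
  then have "D\<^sup>2 \<le> (?c * ?d) * D"
    unfolding D_def using z_common rho_pos by (intro le_mult_infdist) (auto simp: F_def)
  moreover have "0 \<le> ?c * ?d" using rho_pos by simp
  ultimately have "D \<le> ?c * ?d"
    using D0 mult_right_le_imp_le[of D D "?c * ?d"] by (cases "D = 0") (auto simp only: power2_eq_square)
  then show "infdist x (Fix (composition m U)) \<le> ?c * ?d"
    by (simp only: Fix_composition D_def F_def)
qed

end

theorem corollary5p6:
  fixes U :: "nat \<Rightarrow> 'a::{real_inner,complete_space} \<Rightarrow> 'a"
    and \<rho> :: "nat \<Rightarrow> real" and m :: nat and z :: 'a and R :: real
  assumes "m \<ge> 1"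
    and "\<forall>i\<in>{1..m}. strongly_quasi_nonexpansive (\<rho> i) (U i)"
    and "Min (\<rho> ` {1..m}) > 0"
    and "z \<in> (\<Inter>i\<in>{1..m}. Fix (U i))"
    and "R > 0"
  shows "((\<forall>i\<in>{1..m}. weakly_regular_over (U i) (cball z R)) \<longrightarrow>
            weakly_regular_over (composition m U) (cball z R)) \<and>
         ((\<forall>i\<in>{1..m}. regular_over (U i) (cball z R)) \<longrightarrow>
            regular_family_over m (\<lambda>i. Fix (U i)) (cball z R) \<longrightarrow>
            regular_over (composition m U) (cball z R)) \<and>
         (\<forall>(\<delta> :: nat \<Rightarrow> real) (\<kappa> :: real).
            (\<forall>i\<in>{1..m}. \<delta> i \<ge> 1 \<and> linearly_regular_over (U i) (cball z R) (\<delta> i)) \<longrightarrow>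
            linearly_regular_family_over m (\<lambda>i. Fix (U i)) (cball z R) \<kappa> \<longrightarrow>
            linearly_regular_over (composition m U) (cball z R)
              (2 * real m * \<kappa>\<^sup>2 * (Max (\<delta> ` {1..m}))\<^sup>2 / Min (\<rho> ` {1..m})))"
proof -
  have "strongly_quasi_nonexpansive (Min (\<rho> ` {1..m})) (U i)" if "i \<in> {1..m}" for i
    by (rule strongly_quasi_nonexpansive_antimono[of "\<rho> i"]) (use assms(2,3) that in \<open>auto intro: less_imp_le\<close>)
  then interpret strongly_quasi_nonexpansive_product U m "Min (\<rho> ` {1..m})" z
    using assms(3,4) by unfold_locales auto
  have "linearly_regular_over (composition m U) (cball z R)
      (2 * real m * \<kappa>\<^sup>2 * (Max (\<delta> ` {1..m}))\<^sup>2 / Min (\<rho> ` {1..m}))"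
    if lin: "\<forall>i\<in>{1..m}. \<delta> i \<ge> 1 \<and> linearly_regular_over (U i) (cball z R) (\<delta> i)"
      and fam: "linearly_regular_family_over m (\<lambda>i. Fix (U i)) (cball z R) \<kappa>"
    for \<delta> :: "nat \<Rightarrow> real" and \<kappa> :: real
  proof (rule linearly_regular_composition[OF assms(1) _ _ fam])
    have le_Max: "\<delta> i \<le> Max (\<delta> ` {1..m})" if "i \<in> {1..m}" for i
      using that by simp
    have "1 \<in> {1..m}" using assms(1) by simp
    then show "Max (\<delta> ` {1..m}) \<ge> 1"
      using le_Max lin order_trans by blast
    fix i x assume i: "i \<in> {1..m}" and x: "x \<in> cball z R"
    have "infdist x (Fix (U i)) \<le> \<delta> i * norm (U i x - x)"
      using lin i x by (simp add: linearly_regular_over_def)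
    also have "\<dots> \<le> Max (\<delta> ` {1..m}) * norm (U i x - x)"
      using le_Max[OF i] by (intro mult_right_mono) auto
    finally show "infdist x (Fix (U i)) \<le> Max (\<delta> ` {1..m}) * norm (U i x - x)" .
  qed
  then show ?thesis
    using weakly_regular_composition regular_composition assms(1) by blast
qed

end
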